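(* Let $\mathscr{A}=(\mathscr{A},f,g)$ be a commutative Krasner $(m,n)$-hyperring with scalar identity $1_{\mathscr{A}}$, let $S$ be an $n$-ary multiplicative subset of $\mathscr{A}$ containing $1_{\mathscr{A}}$, and let $Q$ be a hyperideal of $\mathscr{A}$. Then $Q^S=\{x\in\mathscr{A}\mid g(t,x,1_{\mathscr{A}}^{(n-2)})\in Q \text{ for some } t\in S\}$ is the smallest $n$-ary $S$-hyperideal of $\mathscr{A}$ containing $Q$.
   Context: Let $m,n\ge 2$. Notation: $p_i^j$ denotes the sequence $p_i,\dots,p_j$ (empty if $j<i$); $p^{(k)}$ denotes $p$ repeated $k$ times; for non-empty subsets, $f(P_1^m)=\bigcup\{f(p_1^m)\mid p_i\in P_i\}$ and similarly for $g$; singletons are identified with elements. A canonical $m$-ary hypergroup $(\mathscr{A},f)$ is a set with $f:\mathscr{A}^m\to\{\text{non-empty subsets of }\mathscr{A}\}$ such that: $f$ is associative ($f(p_1^{i-1},f(p_i^{m+i-1}),p_{m+i}^{2m-1})$ is independent of $i$) and invariant under permutations of its arguments; there is a unique $0$ with $f(p,0^{(m-1)})=\{p\}$ for all $p$; each $p$ has a unique $-p$ with $0\in f(p,-p,0^{(m-2)})$; and $p\in f(p_1^m)$ implies $p_i\in f(p,-p_1,\dots,-p_{i-1},-p_{i+1},\dots,-p_m)$ for each $i$. A commutative Krasner $(m,n)$-hyperring with scalar identity $1_{\mathscr{A}}$ is $(\mathscr{A},f,g)$ with $(\mathscr{A},f)$ a canonical $m$-ary hypergroup, $g:\mathscr{A}^n\to\mathscr{A}$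 an associative operation invariant under permutations of its arguments, $g$ distributive over $f$ in each argument ($g(p_1^{i-1},f(q_1^m),p_{i+1}^n)=f(g(p_1^{i-1},q_1,p_{i+1}^n),\dots,g(p_1^{i-1},q_m,p_{i+1}^n))$), $g(0,p_2^n)=0$, and $g(p,1_{\mathscr{A}}^{(n-1)})=p$ for all $p$. A hyperideal is a non-empty $P\subseteq\mathscr{A}$ with $f(p_1^m)\subseteq P$ and $-p\in P$ for all $p,p_1,\dots,p_m\in P$, and $g(p_1^{i-1},P,p_{i+1}^n)\subseteq P$ for all $p_j\in\mathscr{A}$ and all $i$; it is proper if $P\ne\mathscr{A}$. An $n$-ary multiplicative subset is a non-empty $S\subseteq\mathscr{A}$ with $g(s_1^n)\in S$ for all $s_1,\dots,s_n\in S$. Given such $S$, an $n$-ary $S$-hyperideal is a proper hyperideal $P$ such that whenever $g(p_1^n)\in P$ with $p_1,\dots,p_n\in\mathscr{A}$ and $p_i\in S$ for some $i$, then $g(p_1^{i-1},1_{\mathscr{A}},p_{i+1}^n)\in P$. "Smallest" means with respect to inclusion.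
   Formalization: The hypothesis that Q and S are disjoint is added: S-hyperideals are proper by definition, and if Q meets S (e.g. Q equal to the whole hyperring) then Q^S is the whole hyperring and no S-hyperideal contains Q, so the claim fails in exactly the excluded cases. *)

theory Defs
  imports "HOL-Library.Multiset" "HOL-Library.NList"
begin

text \<open>
  A \<open>k\<close>-ary (hyper)operation on a carrier \<open>A\<close> is a function on lists, constrained only
  on \<open>nlists k A\<close>.  Argument positions are counted from \<open>0\<close>, so the sequence
  \<open>p\<^sub>1, \<dots>, p\<^sub>i\<^sub>-\<^sub>1, q, p\<^sub>i\<^sub>+\<^sub>1, \<dots>, p\<^sub>n\<close> is \<open>ps[i := q]\<close> with \<open>i < n\<close>.
\<close>

definition hyper_ext :: "('a list \<Rightarrow> 'a set) \<Rightarrow> 'a set list \<Rightarrow> 'a set"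
  where "hyper_ext f Ps = \<Union> {f ps | ps. list_all2 (\<in>) ps Ps}"

definition hyper_zero :: "'a set \<Rightarrow> nat \<Rightarrow> ('a list \<Rightarrow> 'a set) \<Rightarrow> 'a"
  where "hyper_zero A m f = (THE z. z \<in> A \<and> (\<forall>p\<in>A. f (p # replicate (m - 1) z) = {p}))"

definition hyper_neg :: "'a set \<Rightarrow> nat \<Rightarrow> ('a list \<Rightarrow> 'a set) \<Rightarrow> 'a \<Rightarrow> 'a"
  where "hyper_neg A m f p =
    (THE q. q \<in> A \<and> hyper_zero A m f \<in> f (p # q # replicate (m - 2) (hyper_zero A m f)))"

locale canonical_hypergroup =
  fixes A :: "'a set" and m :: nat and f :: "'a list \<Rightarrow> 'a set"
  assumes m_ge_2: "2 \<le> m"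
    and f_closed: "ps \<in> nlists m A \<Longrightarrow> f ps \<subseteq> A"
    and f_nonempty: "ps \<in> nlists m A \<Longrightarrow> f ps \<noteq> {}"
    and f_assoc: "\<lbrakk> ps \<in> nlists (2 * m - 1) A; i < m; j < m \<rbrakk> \<Longrightarrow>
      hyper_ext f (map (\<lambda>p. {p}) (take i ps) @ [f (take m (drop i ps))]
                   @ map (\<lambda>p. {p}) (drop (i + m) ps)) =
      hyper_ext f (map (\<lambda>p. {p}) (take j ps) @ [f (take m (drop j ps))]
                   @ map (\<lambda>p. {p}) (drop (j + m) ps))"
    and f_perm: "\<lbrakk> ps \<in> nlists m A; mset qs = mset ps \<rbrakk> \<Longrightarrow> f qs = f ps"
    and zero_unique: "\<exists>!z. z \<in> A \<and> (\<forall>p\<in>A. f (p # replicate (m - 1) z) = {p})"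
    and neg_unique: "p \<in> A \<Longrightarrow>
      \<exists>!q. q \<in> A \<and> hyper_zero A m f \<in> f (p # q # replicate (m - 2) (hyper_zero A m f))"
    and reversible: "\<lbrakk> ps \<in> nlists m A; p \<in> f ps; i < m \<rbrakk> \<Longrightarrow>
      ps ! i \<in> f (p # map (hyper_neg A m f) (take i ps @ drop (Suc i) ps))"

locale comm_krasner_hyperring = canonical_hypergroup A m f
  for A :: "'a set" and m :: nat and f :: "'a list \<Rightarrow> 'a set" +
  fixes n :: nat and g :: "'a list \<Rightarrow> 'a" and e :: 'a
  assumes n_ge_2: "2 \<le> n"
    and g_closed: "ps \<in> nlists n A \<Longrightarrow> g ps \<in> A"
    and g_assoc: "\<lbrakk> ps \<in> nlists (2 * n - 1) A; i < n; j < n \<rbrakk> \<Longrightarrow>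
      g (take i ps @ [g (take n (drop i ps))] @ drop (i + n) ps) =
      g (take j ps @ [g (take n (drop j ps))] @ drop (j + n) ps)"
    and g_perm: "\<lbrakk> ps \<in> nlists n A; mset qs = mset ps \<rbrakk> \<Longrightarrow> g qs = g ps"
    and distrib: "\<lbrakk> ps \<in> nlists n A; qs \<in> nlists m A; i < n \<rbrakk> \<Longrightarrow>
      (\<lambda>q. g (ps[i := q])) ` f qs = f (map (\<lambda>q. g (ps[i := q])) qs)"
    and g_zero: "ps \<in> nlists (n - 1) A \<Longrightarrow> g (hyper_zero A m f # ps) = hyper_zero A m f"
    and one_closed: "e \<in> A"
    and g_one: "p \<in> A \<Longrightarrow> g (p # replicate (n - 1) e) = p"

definition hyperideal ::
    "'a set \<Rightarrow> nat \<Rightarrow> ('a list \<Rightarrow> 'a set) \<Rightarrow> nat \<Rightarrow> ('a list \<Rightarrow> 'a) \<Rightarrow> 'a set \<Rightarrow> bool"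
  where "hyperideal A m f n g P \<longleftrightarrow>
    P \<subseteq> A \<and> P \<noteq> {} \<and>
    (\<forall>ps \<in> nlists m P. f ps \<subseteq> P) \<and>
    (\<forall>p \<in> P. hyper_neg A m f p \<in> P) \<and>
    (\<forall>ps \<in> nlists n A. \<forall>i < n. \<forall>p \<in> P. g (ps[i := p]) \<in> P)"

definition multiplicative_subset :: "'a set \<Rightarrow> nat \<Rightarrow> ('a list \<Rightarrow> 'a) \<Rightarrow> 'a set \<Rightarrow> bool"
  where "multiplicative_subset A n g S \<longleftrightarrow>
    S \<subseteq> A \<and> S \<noteq> {} \<and> (\<forall>ss \<in> nlists n S. g ss \<in> S)"

definition S_hyperideal ::
    "'a set \<Rightarrow> nat \<Rightarrow> ('a list \<Rightarrow> 'a set) \<Rightarrow> nat \<Rightarrow> ('a list \<Rightarrow> 'a) \<Rightarrow> 'a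
     \<Rightarrow> 'a set \<Rightarrow> 'a set \<Rightarrow> bool"
  where "S_hyperideal A m f n g e S P \<longleftrightarrow>
    hyperideal A m f n g P \<and> P \<noteq> A \<and>
    (\<forall>ps \<in> nlists n A. \<forall>i < n. g ps \<in> P \<and> ps ! i \<in> S \<longrightarrow> g (ps[i := e]) \<in> P)"

definition S_extension ::
    "'a set \<Rightarrow> nat \<Rightarrow> ('a list \<Rightarrow> 'a) \<Rightarrow> 'a \<Rightarrow> 'a set \<Rightarrow> 'a set \<Rightarrow> 'a set"
  where "S_extension A n g e S Q =
    {x \<in> A. \<exists>t \<in> S. g (t # x # replicate (n - 2) e) \<in> Q}"

text \<open>
  Since \<open>S_hyperideal\<close> demands properness, no \<open>S\<close>-hyperideal meets \<open>S\<close>.  Hence a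
  hyperideal \<open>Q\<close> lies in some \<open>S\<close>-hyperideal only if \<open>Q \<inter> S = {}\<close>.
\<close>

lemma (in comm_krasner_hyperring) S_hyperideal_disjoint:
  assumes "S_hyperideal A m f n g e S P"
  shows "P \<inter> S = {}"
proof (rule ccontr)
  assume "P \<inter> S \<noteq> {}"
  then obtain s where s: "s \<in> P" "s \<in> S" by blast
  have PA: "P \<subseteq> A" and neq: "P \<noteq> A"
    using assms by (simp_all add: S_hyperideal_def hyperideal_def)
  obtain k where k: "n = Suc k" using n_ge_2 by (cases n) auto
  have args: "p # replicate k e \<in> nlists n A" if "p \<in> A" for p
    using that one_closed by (intro nlistsI) (auto simp: k)
  have "\<forall>ps \<in> nlists n A. \<forall>i < n. g ps \<in> P \<and> ps ! i \<in> S \<longrightarrow> g (ps[i := e]) \<in> P"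
    using assms by (simp add: S_hyperideal_def)
  moreover have "g (s # replicate k e) \<in> P" using g_one[of s] s PA by (simp add: k subsetD)
  ultimately have "g ((s # replicate k e)[0 := e]) \<in> P"
    using args[of s] s PA n_ge_2 by (metis nth_Cons_0 subsetD k zero_less_Suc)
  then have eP: "e \<in> P"
    using g_one[OF one_closed] by (simp add: k)
  have "x \<in> P" if x: "x \<in> A" for x
  proof -
    have "\<forall>ps \<in> nlists n A. \<forall>i < n. \<forall>p \<in> P. g (ps[i := p]) \<in> P"
      using assms by (simp add: S_hyperideal_def hyperideal_def)
    moreover have "1 < n" using n_ge_2 by simp
    ultimately have "g ((x # replicate k e)[1 := e]) \<in> P"
      using eP args[OF x] by blast
    moreover have "(x # replicate k e)[1 := e] = x # replicate k e"
      using n_ge_2 k by (cases k) auto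
    ultimately show ?thesis using g_one[OF x] by (simp add: k)
  qed
  then show False using PA neq by blast
qed

end

theory Submission
  imports Defs
begin

text \<open>
  The product \<open>x \<odot> y = g(x, y, 1, \<dots>, 1)\<close> makes the hyperring a commutative monoid that
  distributes over \<open>f\<close>, and \<open>g ps = p\<^sub>i \<odot> g (ps[i := 1])\<close>.  So the \<open>n\<close>-ary notions reduce to binary
  ones: \<open>Q\<^sup>S\<close> is the saturation of \<open>Q\<close> by \<open>S\<close>, where finitely many denominators
  are replaced by their product.
\<close>

context comm_krasner_hyperring
begin

abbreviation zero :: 'a ("\<zero>")
  where "\<zero> \<equiv> hyper_zero A m f"

abbreviation neg :: "'a \<Rightarrow> 'a"
  where "neg \<equiv> hyper_neg A m f"

section \<open>Binary product: commutative monoid laws and factorisation of \<open>g\<close>\<close>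

definition mul :: "'a \<Rightarrow> 'a \<Rightarrow> 'a" (infixl "\<odot>" 70)
  where "x \<odot> y = g (x # y # replicate (n - 2) e)"

lemma mul_args:
  assumes "x \<in> A" "y \<in> A"
  shows "x # y # replicate (n - 2) e \<in> nlists n A"
  using assms one_closed n_ge_2 by (intro nlistsI) auto

lemma mul_closed: "x \<in> A \<Longrightarrow> y \<in> A \<Longrightarrow> x \<odot> y \<in> A"
  unfolding mul_def by (intro g_closed mul_args)

lemma mul_commute: "x \<in> A \<Longrightarrow> y \<in> A \<Longrightarrow> x \<odot> y = y \<odot> x"
  unfolding mul_def by (rule g_perm) (auto simp: mul_args)

lemma mul_one:
  assumes "x \<in> A"
  shows "x \<odot> e = x"
proof -
  obtain k where "n = Suc (Suc k)"
    using n_ge_2 by (metis add_2_eq_Suc le_Suc_ex)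
  then show ?thesis
    unfolding mul_def using g_one[OF assms] by simp
qed

lemma one_mul: "x \<in> A \<Longrightarrow> e \<odot> x = x"
  by (simp add: mul_commute[OF one_closed] mul_one)

lemma mul_assoc:
  assumes "x \<in> A" "y \<in> A" "z \<in> A"
  shows "x \<odot> y \<odot> z = x \<odot> (y \<odot> z)"
proof -
  let ?E = "replicate (n - 2) e"
  obtain k where k: "n = Suc (Suc k)"
    using n_ge_2 by (metis add_2_eq_Suc le_Suc_ex)
  \<comment> \<open>Bracketing this word at position 0 gives \<open>x \<odot> y \<odot> z\<close>.
    At position 1 it gives \<open>x\<close> times \<open>g (y # ?E @ [z])\<close>, where symmetry
    then moves \<open>z\<close> forward.\<close>
  let ?ps = "x # y # ?E @ z # ?E"
  have "?ps \<in> nlists (2 * n - 1) A"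
    using assms one_closed by (intro nlistsI) (auto simp: k)
  from g_assoc[OF this, of 0 1]
  have "x \<odot> y \<odot> z = g (x # g (y # ?E @ [z]) # ?E)"
    unfolding mul_def by (simp add: k)
  also have "g (y # ?E @ [z]) = y \<odot> z"
    unfolding mul_def by (rule g_perm) (auto simp: assms mul_args)
  finally show ?thesis
    by (simp add: mul_def)
qed

text \<open>Associativity on a word padded with units splits off the first argument; the unit left
  in its place keeps the remaining product \<open>n\<close>-ary.\<close>

lemma g_Cons:
  assumes "x # xs \<in> nlists n A"
  shows "g (x # xs) = x \<odot> g (e # xs)"
proof -
  obtain k where k: "n = Suc (Suc k)"
    using n_ge_2 by (metis add_2_eq_Suc le_Suc_ex)
  have xs: "x \<in> A" "set xs \<subseteq> A" "length xs = Suc k"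
    using nlistsE_length[OF assms] nlistsE_set[OF assms] by (simp_all add: k)
  \<comment> \<open>With \<open>n - 1\<close> units appended, bracketing at 0 leaves
    \<open>g (x # xs)\<close> times units, hence \<open>g (x # xs)\<close> by \<open>g_one\<close>.
    Bracketing at 1 moves exactly one unit into the inner product.\<close>
  have "x # xs @ replicate (n - 1) e \<in> nlists (2 * n - 1) A"
    using xs one_closed by (intro nlistsI) (auto simp: k)
  from g_assoc[OF this, of 0 1]
  have "g (x # xs) = g (x # g (xs @ [e]) # replicate (n - 2) e)"
    using xs g_one[of "g (x # xs)"] g_closed[OF assms] by (simp add: k)
  also have "g (xs @ [e]) = g (e # xs)"
    using xs one_closed by (intro g_perm nlistsI) (auto simp: k)
  finally show ?thesis
    by (simp add: mul_def)
qed

text \<open>By symmetry any argument can be moved to the front, so \<open>g_Cons\<close> applies at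
  every position. This turns the replacement of an argument by \<open>e\<close> into cancellation of
  a factor.\<close>

lemma g_factor:
  assumes "ps \<in> nlists n A" "i < n"
  shows "g ps = ps ! i \<odot> g (ps[i := e])"
proof -
  let ?r = "take i ps @ drop (Suc i) ps"
  have ps: "set ps \<subseteq> A" "length ps = n"
    using nlistsE_length[OF assms(1)] nlistsE_set[OF assms(1)] by simp_all
  then have "take i ps @ ps ! i # drop (Suc i) ps = ps"
    using assms(2) by (simp flip: id_take_nth_drop)
  then have split: "mset ps = mset (ps ! i # ?r)"
    by (metis mset.simps(2) mset_append union_mset_add_mset_right)
  have "ps ! i \<in> A" "set ?r \<subseteq> A"
    using ps assms(2) by (auto dest!: in_set_takeD in_set_dropD)
  moreover have "length ?r = n - 1"
    using ps assms(2) by auto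
  ultimately have args: "x # ?r \<in> nlists n A" if "x \<in> A" for x
    using that n_ge_2 by (intro nlistsI) auto
  have "g ps = g (ps ! i # ?r)"
    using \<open>ps ! i \<in> A\<close> split by (intro g_perm args)
  also have "\<dots> = ps ! i \<odot> g (e # ?r)"
    using \<open>ps ! i \<in> A\<close> by (intro g_Cons args)
  also have "g (e # ?r) = g (ps[i := e])"
    using ps assms(2) args[OF one_closed]
    by (intro g_perm[symmetric]) (simp_all add: upd_conv_take_nth_drop)
  finally show ?thesis .
qed

lemma g_update:
  assumes "ps \<in> nlists n A" "i < n" "x \<in> A"
  shows "g (ps[i := x]) = x \<odot> g (ps[i := e])"
  using g_factor[OF nlists_update_in_list[OF assms(1,3), of i] assms(2)] assms
  by simp

section \<open>The product against \<open>f\<close>, zero and negatives\<close>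

lemma mul_distrib:
  assumes "t \<in> A" "qs \<in> nlists m A"
  shows "(\<odot>) t ` f qs = f (map ((\<odot>) t) qs)"
  \<comment> \<open>The \<open>e\<close> at position 1 is only a placeholder, overwritten by the
    update in \<open>distrib\<close>.\<close>
  using distrib[OF mul_args[OF assms(1) one_closed] assms(2), of 1] n_ge_2
  by (simp add: mul_def[abs_def])

lemma zero_closed: "\<zero> \<in> A"
  using theI'[OF zero_unique] by (simp add: hyper_zero_def)

lemma mul_zero: "t \<in> A \<Longrightarrow> t \<odot> \<zero> = \<zero>"
proof -
  assume t: "t \<in> A"
  have "\<zero> \<odot> t = \<zero>"
    unfolding mul_def using t one_closed n_ge_2 by (intro g_zero nlistsI) auto
  then show ?thesis
    using mul_commute[OF t zero_closed] by simp
qed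

lemma
  assumes "p \<in> A"
  shows neg_closed: "neg p \<in> A"
    and zero_in_f_neg: "\<zero> \<in> f (p # neg p # replicate (m - 2) \<zero>)"
  using theI'[OF neg_unique[OF assms]] by (simp_all add: hyper_neg_def)

text \<open>Multiplying the defining relation of \<open>neg p\<close> by \<open>t\<close> shows that
  \<open>t \<odot> neg p\<close> satisfies the one of \<open>neg (t \<odot> p)\<close>; negatives
  are unique.\<close>

lemma mul_neg:
  assumes "t \<in> A" "p \<in> A"
  shows "t \<odot> neg p = neg (t \<odot> p)"
proof -
  have "p # neg p # replicate (m - 2) \<zero> \<in> nlists m A"
    using assms neg_closed zero_closed m_ge_2 by (intro nlistsI) auto
  from mul_distrib[OF assms(1) this]
  have "\<zero> \<in> f (t \<odot> p # t \<odot> neg p # replicate (m - 2) \<zero>)"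
    using imageI[OF zero_in_f_neg[OF assms(2)], of "(\<odot>) t"] assms by (simp add: mul_zero)
  then show ?thesis
    unfolding hyper_neg_def[of _ _ _ "t \<odot> p"]
    using neg_unique[OF mul_closed[OF assms]] assms mul_closed neg_closed
    by (intro the1_equality[symmetric]) simp_all
qed

section \<open>Hyperideals and their saturation by \<open>S\<close>\<close>

lemma hyperideal_mul_closed:
  assumes "hyperideal A m f n g P" "x \<in> P" "y \<in> A"
  shows "x \<odot> y \<in> P"
proof -
  have "x \<in> A"
    using assms by (auto simp: hyperideal_def)
  then have "x # y # replicate (n - 2) e \<in> nlists n A"
    using assms(3) by (rule mul_args)
  moreover have "0 < n"
    using n_ge_2 by simp
  ultimately have "g ((x # y # replicate (n - 2) e)[0 := x]) \<in> P"
    using assms(1,2) unfolding hyperideal_def by blast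
  then show ?thesis
    by (simp add: mul_def)
qed

lemma multiplicative_subset_mul_closed:
  assumes "multiplicative_subset A n g S" "e \<in> S" "s \<in> S" "t \<in> S"
  shows "s \<odot> t \<in> S"
proof -
  have "s # t # replicate (n - 2) e \<in> nlists n S"
    using assms n_ge_2 by (intro nlistsI) auto
  then show ?thesis
    using assms(1) by (simp add: multiplicative_subset_def mul_def)
qed

lemma mem_S_extension:
  "x \<in> S_extension A n g e S Q \<longleftrightarrow> x \<in> A \<and> (\<exists>t\<in>S. t \<odot> x \<in> Q)"
  by (simp add: S_extension_def mul_def)

lemma S_extension_common_multiplier:
  assumes S: "multiplicative_subset A n g S" "e \<in> S"
    and Q: "hyperideal A m f n g Q"
    and "set ps \<subseteq> S_extension A n g e S Q"
  shows "\<exists>t\<in>S. \<forall>p\<in>set ps. t \<odot> p \<in> Q"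
  using assms(4)
proof (induction ps)
  case Nil
  then show ?case using S(2) by auto
next
  case (Cons p ps)
  have SA: "S \<subseteq> A"
    using S by (simp add: multiplicative_subset_def)
  from Cons obtain t where t: "t \<in> S" "\<forall>q\<in>set ps. t \<odot> q \<in> Q" by auto
  from Cons.prems obtain s where s: "s \<in> S" "s \<odot> p \<in> Q" "p \<in> A"
    by (auto simp: mem_S_extension)
  have A: "s \<in> A" "t \<in> A"
    using s t SA by auto
  have "(s \<odot> t) \<odot> q \<in> Q" if "q \<in> set (p # ps)" for q
  proof (cases "q = p")
    case True
    \<comment> \<open>Reordering isolates the factor already in \<open>Q\<close>, which then absorbs
      the other multiplier.\<close>
    have "(s \<odot> t) \<odot> p = (s \<odot> p) \<odot> t"
      using A s by (simp add: mul_assoc mul_commute[of t p])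
    then show ?thesis
      using True A s hyperideal_mul_closed[OF Q] by simp
  next
    case False
    with that have q: "q \<in> set ps" "q \<in> A"
      using Cons.prems by (auto simp: mem_S_extension)
    then have "(s \<odot> t) \<odot> q = (t \<odot> q) \<odot> s"
      using A mul_assoc mul_closed mul_commute by metis
    then show ?thesis
      using q A t hyperideal_mul_closed[OF Q] by simp
  qed
  then show ?case
    using multiplicative_subset_mul_closed[OF S s(1) t(1)] by blast
qed

lemma hyperideal_subset_S_extension:
  assumes "e \<in> S" "hyperideal A m f n g Q"
  shows "Q \<subseteq> S_extension A n g e S Q"
proof
  fix x assume "x \<in> Q"
  moreover from this have "x \<in> A"
    using assms by (auto simp: hyperideal_def)
  ultimately show "x \<in> S_extension A n g e S Q"
    using assms one_mul by (auto simp: mem_S_extension intro!: bexI[of _ e])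
qed

text \<open>A common multiplier \<open>t\<close> commutes with \<open>f\<close>, so it carries
  \<open>f ps\<close> into \<open>Q\<close>. For negatives and for absorption, the multiplier of the
  given element can be kept.\<close>

lemma hyperideal_S_extension:
  assumes S: "multiplicative_subset A n g S" "e \<in> S"
    and Q: "hyperideal A m f n g Q"
  shows "hyperideal A m f n g (S_extension A n g e S Q)" (is "hyperideal A m f n g ?E")
  unfolding hyperideal_def
proof (intro conjI ballI allI impI)
  have SA: "S \<subseteq> A"
    using S by (simp add: multiplicative_subset_def)
  show EA: "?E \<subseteq> A"
    by (auto simp: mem_S_extension)
  show "?E \<noteq> {}"
    using hyperideal_subset_S_extension[OF S(2) Q] Q by (auto simp: hyperideal_def)
  show "f ps \<subseteq> ?E" if ps: "ps \<in> nlists m ?E" for ps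
  proof
    fix x assume x: "x \<in> f ps"
    have psA: "ps \<in> nlists m A"
      using ps EA nlists_mono by blast
    have "set ps \<subseteq> ?E"
      using ps by simp
    then obtain t where t: "t \<in> S" "\<forall>p\<in>set ps. t \<odot> p \<in> Q"
      using S_extension_common_multiplier[OF S Q] by blast
    then have "map ((\<odot>) t) ps \<in> nlists m Q"
      using ps by (intro nlistsI) auto
    then have "f (map ((\<odot>) t) ps) \<subseteq> Q"
      using Q by (simp add: hyperideal_def)
    then have "t \<odot> x \<in> Q"
      using mul_distrib[OF _ psA, of t] t SA x by auto
    then show "x \<in> ?E"
      using t x f_closed[OF psA] by (auto simp: mem_S_extension)
  qed
  show "neg p \<in> ?E" if "p \<in> ?E" for p
  proof -
    from that obtain t where t: "t \<in> S" "t \<odot> p \<in> Q" "p \<in> A"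
      by (auto simp: mem_S_extension)
    then have "t \<odot> neg p \<in> Q"
      using Q SA by (auto simp: mul_neg hyperideal_def)
    then show ?thesis
      using t neg_closed by (auto simp: mem_S_extension)
  qed
  show "g (ps[i := p]) \<in> ?E" if ps: "ps \<in> nlists n A" "i < n" and p: "p \<in> ?E" for ps i p
  proof -
    let ?c = "g (ps[i := e])"
    from p obtain t where t: "t \<in> S" "t \<odot> p \<in> Q" "p \<in> A"
      by (auto simp: mem_S_extension)
    have c: "?c \<in> A"
      using ps one_closed by (intro g_closed nlists_update_in_list)
    then have "t \<odot> (p \<odot> ?c) \<in> Q"
      using hyperideal_mul_closed[OF Q t(2) c] t SA by (simp add: mul_assoc subset_iff)
    then show ?thesis
      using t c ps by (auto simp: g_update mem_S_extension mul_closed)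
  qed
qed

lemma S_hyperideal_S_extension:
  assumes S: "multiplicative_subset A n g S" "e \<in> S"
    and Q: "hyperideal A m f n g Q" "Q \<inter> S = {}"
  shows "S_hyperideal A m f n g e S (S_extension A n g e S Q)" (is "S_hyperideal A m f n g e S ?E")
  unfolding S_hyperideal_def
proof (intro conjI ballI allI impI)
  have SA: "S \<subseteq> A"
    using S by (simp add: multiplicative_subset_def)
  show "hyperideal A m f n g ?E"
    by (rule hyperideal_S_extension[OF S Q(1)])
  \<comment> \<open>If \<open>e\<close> belonged to \<open>?E\<close>, some \<open>t\<close> in
    \<open>S\<close> would satisfy \<open>t = t \<odot> e \<in> Q\<close>, against
    disjointness.\<close>
  have "e \<notin> ?E"
    using Q(2) SA by (auto simp: mem_S_extension mul_one subset_iff)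
  then show "?E \<noteq> A"
    using one_closed by blast
  fix ps i
  assume ps: "ps \<in> nlists n A" and i: "i < n" and gs: "g ps \<in> ?E \<and> ps ! i \<in> S"
  let ?c = "g (ps[i := e])"
  from gs obtain t where t: "t \<in> S" "t \<odot> g ps \<in> Q"
    by (auto simp: mem_S_extension)
  have c: "?c \<in> A"
    using ps one_closed by (intro g_closed nlists_update_in_list)
  \<comment> \<open>The argument to be replaced lies in \<open>S\<close>, so it can be merged into
    the multiplier.\<close>
  have "(t \<odot> ps ! i) \<odot> ?c = t \<odot> g ps"
    using g_factor[OF ps i] t gs SA c by (simp add: mul_assoc subset_iff)
  then show "?c \<in> ?E"
    using t gs c multiplicative_subset_mul_closed[OF S, of t "ps ! i"]
    by (auto simp: mem_S_extension intro!: bexI[of _ "t \<odot> ps ! i"])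
qed

text \<open>The \<open>S\<close>-condition on \<open>P\<close>, applied at position 0 of
  \<open>t # x # replicate (n - 2) e\<close>, cancels \<open>t\<close> and leaves
  \<open>e \<odot> x = x\<close>.\<close>

lemma S_extension_least:
  assumes S: "multiplicative_subset A n g S"
    and P: "S_hyperideal A m f n g e S P" "Q \<subseteq> P"
  shows "S_extension A n g e S Q \<subseteq> P"
proof
  fix x assume "x \<in> S_extension A n g e S Q"
  then obtain t where t: "t \<in> S" "t \<odot> x \<in> P" "x \<in> A"
    using P(2) by (auto simp: mem_S_extension)
  let ?ps = "t # x # replicate (n - 2) e"
  have "?ps \<in> nlists n A"
    using t S by (intro mul_args) (auto simp: multiplicative_subset_def)
  moreover have "0 < n"
    using n_ge_2 by simp
  moreover have "g ?ps \<in> P \<and> ?ps ! 0 \<in> S"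
    using t by (simp add: mul_def)
  ultimately have "g (?ps[0 := e]) \<in> P"
    using P(1) unfolding S_hyperideal_def by blast
  then show "x \<in> P"
    using one_mul[OF t(3)] by (simp add: mul_def)
qed

end

text \<open>Disjointness of \<open>Q\<close> and \<open>S\<close> supplies properness of the
  extension. It is forced, since \<open>S_hyperideal_disjoint\<close> shows that an
  \<open>S\<close>-hyperideal containing \<open>Q\<close> misses \<open>S\<close>.\<close>

theorem theorem3p8:
  fixes A :: "'a set" and m n :: nat
    and f :: "'a list \<Rightarrow> 'a set" and g :: "'a list \<Rightarrow> 'a" and e :: 'a
    and S Q :: "'a set"
  assumes "comm_krasner_hyperring A m f n g e"
    and "multiplicative_subset A n g S"
    and "e \<in> S"
    and "hyperideal A m f n g Q"
    and "Q \<inter> S = {}"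
  shows "S_hyperideal A m f n g e S (S_extension A n g e S Q) \<and>
         Q \<subseteq> S_extension A n g e S Q \<and>
         (\<forall>P. S_hyperideal A m f n g e S P \<and> Q \<subseteq> P \<longrightarrow> S_extension A n g e S Q \<subseteq> P)"
proof -
  interpret comm_krasner_hyperring A m f n g e
    by (rule assms(1))
  show ?thesis
  proof (intro conjI allI impI)
    show "S_hyperideal A m f n g e S (S_extension A n g e S Q)"
      by (rule S_hyperideal_S_extension[OF assms(2-5)])
    show "Q \<subseteq> S_extension A n g e S Q"
      by (rule hyperideal_subset_S_extension[OF assms(3,4)])
    show "S_extension A n g e S Q \<subseteq> P"
      if "S_hyperideal A m f n g e S P \<and> Q \<subseteq> P" for P
      using that by (intro S_extension_least[OF assms(2)]) simp_all
  qed
qed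

end
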